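(* Let $F$ be a correlation-free cellular automaton (CFCA). If $\mathcal{S}_F^t$ is number-conserving and surjective for some $t>0$, then $F$ is deterministic.
   Context: A (one-dimensional) stochastic cellular automaton is a tuple $(Q,R,V,V',f)$ where $Q$ (states) and $R$ (random symbols) are finite sets, $V=\{v_1,\dots,v_\rho\}$ and $V'=\{v'_1,\dots,v'_{\rho'}\}$ are finite subsets of $\mathbb{Z}$, and $f:Q^\rho\times R^{\rho'}\to Q$. It is a CFCA if $V'=\{0\}$. It is identified with its explicit global function $F:Q^{\mathbb{Z}}\times R^{\mathbb{Z}}\to Q^{\mathbb{Z}}$, $F(c,s)_z=f\big((c_{z+v_j})_j,(s_{z+v'_j})_j\big)$. Iterates: $F^0(c)=c$, $F^{t+1}(c,s^1,\dots,s^{t+1})=F(F^t(c,s^1,\dots,s^t),s^{t+1})$. $\mathcal{S}_F^t(c)$ is the law of $F^t(c,s^1,\dots,s^t)$ when $s^1,\dots,s^t$ are independent and each drawn from the uniform (i.i.d. uniform product) measure on $R^{\mathbb{Z}}$. $F$ is deterministic if $f$ does not depend on its second argument (the random symbols). A configuration is finite if it has finitely many cells in a state other than $0$. $\mathcal{S}_F^t$ is number-conserving if $Q=\{0,\dots,q\}$ for some $q\in\mathbb{N}$ and for every finite configuration $c\in Q^{\mathbb{Z}}$, $\big(\mathcal{S}_F^t(c)\big)(\{c':\sum_i c'_i=\sum_i c_i\})=1$, where the sums range over $\mathbb{Z}$ and only finite configurations $c'$ are considered. $\mathcal{S}_F^t$ is surjective if for every $c\in Q^{\mathbb{Z}}$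 there are $c'\in Q^{\mathbb{Z}}$ and $s^1,\dots,s^t\in R^{\mathbb{Z}}$ with $F^t(c',s^1,\dots,s^t)=c$. *)

theory Defs
  imports "HOL-Probability.Probability"
begin

text \<open>
  The neighbourhoods are finite subsets of the integers together with an enumeration, i.e.
  distinct lists; the local rule receives the neighbour states and the neighbour random
  symbols in the order of these lists.
\<close>

record ('q, 'r) stoch_ca =
  states :: "'q set"
  symbols :: "'r set"
  nbhd :: "int list"
  rnbhd :: "int list"
  rule :: "'q list \<Rightarrow> 'r list \<Rightarrow> 'q"

text \<open>
  Non-emptiness of the symbol set is what makes the uniform distribution on it exist.
\<close>

definition stochastic_ca :: "('q, 'r) stoch_ca \<Rightarrow> bool" where
  "stochastic_ca A \<longleftrightarrow>
     finite (states A) \<and> finite (symbols A) \<and> symbols A \<noteq> {} \<and>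
     distinct (nbhd A) \<and> distinct (rnbhd A) \<and>
     (\<forall>xs rs. set xs \<subseteq> states A \<and> length xs = length (nbhd A) \<and>
              set rs \<subseteq> symbols A \<and> length rs = length (rnbhd A)
              \<longrightarrow> rule A xs rs \<in> states A)"

definition cfca :: "('q, 'r) stoch_ca \<Rightarrow> bool" where
  "cfca A \<longleftrightarrow> stochastic_ca A \<and> set (rnbhd A) = {0}"

definition deterministic :: "('q, 'r) stoch_ca \<Rightarrow> bool" where
  "deterministic A \<longleftrightarrow>
     (\<forall>xs rs rs'. set xs \<subseteq> states A \<and> length xs = length (nbhd A) \<and>
                  set rs \<subseteq> symbols A \<and> length rs = length (rnbhd A) \<and>
                  set rs' \<subseteq> symbols A \<and> length rs' = length (rnbhd A)
                  \<longrightarrow> rule A xs rs = rule A xs rs')"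

definition global_map ::
  "('q, 'r) stoch_ca \<Rightarrow> (int \<Rightarrow> 'q) \<Rightarrow> (int \<Rightarrow> 'r) \<Rightarrow> (int \<Rightarrow> 'q)" where
  "global_map A c s =
     (\<lambda>z. rule A (map (\<lambda>v. c (z + v)) (nbhd A)) (map (\<lambda>v. s (z + v)) (rnbhd A)))"

text \<open>
  In \<open>global_iter A t c s\<close>, the random configuration used at step \<open>i\<close> is \<open>s i\<close>, for
  \<open>i = 1, \<dots>, t\<close>; the other entries of \<open>s\<close> are ignored.
\<close>

primrec global_iter ::
  "('q, 'r) stoch_ca \<Rightarrow> nat \<Rightarrow> (int \<Rightarrow> 'q) \<Rightarrow> (nat \<Rightarrow> int \<Rightarrow> 'r) \<Rightarrow> (int \<Rightarrow> 'q)" where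
  "global_iter A 0 c s = c"
| "global_iter A (Suc t) c s = global_map A (global_iter A t c s) (s (Suc t))"

definition random_measure :: "('q, 'r) stoch_ca \<Rightarrow> (int \<Rightarrow> 'r) measure" where
  "random_measure A = (\<Pi>\<^sub>M z\<in>UNIV. uniform_count_measure (symbols A))"

definition config_space :: "('q, 'r) stoch_ca \<Rightarrow> (int \<Rightarrow> 'q) measure" where
  "config_space A = (\<Pi>\<^sub>M z\<in>UNIV. count_space (states A))"

definition law :: "('q, 'r) stoch_ca \<Rightarrow> nat \<Rightarrow> (int \<Rightarrow> 'q) \<Rightarrow> (int \<Rightarrow> 'q) measure" where
  "law A t c = distr (\<Pi>\<^sub>M i\<in>{1..t}. random_measure A) (config_space A) (global_iter A t c)"

definition finite_config :: "(int \<Rightarrow> nat) \<Rightarrow> bool" where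
  "finite_config c \<longleftrightarrow> finite {i. c i \<noteq> 0}"

definition config_sum :: "(int \<Rightarrow> nat) \<Rightarrow> nat" where
  "config_sum c = (\<Sum>i | c i \<noteq> 0. c i)"

definition number_conserving :: "(nat, 'r) stoch_ca \<Rightarrow> nat \<Rightarrow> bool" where
  "number_conserving A t \<longleftrightarrow>
     (\<exists>q. states A = {0..q}) \<and>
     (\<forall>c \<in> UNIV \<rightarrow> states A. finite_config c \<longrightarrow>
        measure (law A t c)
          {c' \<in> UNIV \<rightarrow> states A. finite_config c' \<and> config_sum c' = config_sum c} = 1)"

definition surjective_ca :: "('q, 'r) stoch_ca \<Rightarrow> nat \<Rightarrow> bool" where
  "surjective_ca A t \<longleftrightarrow>
     (\<forall>c \<in> UNIV \<rightarrow> states A. \<exists>c' \<in> UNIV \<rightarrow> states A. \<exists>s \<in> {1..t} \<rightarrow> UNIV \<rightarrow> symbols A.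
        global_iter A t c' s = c)"

end

theory Submission
  imports Defs
begin

text \<open>
  Every cylinder of random symbols has positive probability and the automaton is local, so
  almost sure number conservation of \<open>F\<^sup>t\<close> on finite configurations holds for every choice of
  the random symbols. If the local rule depended on the random symbol for some neighbourhood
  pattern, surjectivity of \<open>F\<^bsup>t-1\<^esup>\<close> and locality would give a finite configuration that reaches
  this pattern around the origin after \<open>t - 1\<close> steps. Changing only the random symbol of the origin
  in the last step then changes exactly one cell of the result, hence its sum.
\<close>

lemma cfca_rnbhd: "cfca A \<Longrightarrow> rnbhd A = [0]"
  unfolding cfca_def stochastic_ca_def
  by (metis distinct.simps(2) insert_iff list.simps(15) singletonD neq_Nil_conv set_empty2 insert_not_empty)

lemma global_map_in_states:
  assumes "stochastic_ca A" "c \<in> UNIV \<rightarrow> states A" "s \<in> UNIV \<rightarrow> symbols A"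
  shows "global_map A c s \<in> UNIV \<rightarrow> states A"
proof
  fix z :: int
  have "set (map (\<lambda>v. c (z + v)) (nbhd A)) \<subseteq> states A"
    "set (map (\<lambda>v. s (z + v)) (rnbhd A)) \<subseteq> symbols A"
    using assms(2,3) by auto
  then show "global_map A c s z \<in> states A"
    using assms(1) unfolding stochastic_ca_def global_map_def by (metis length_map)
qed

lemma global_map_cfca:
  assumes "cfca A"
  shows "global_map A c s z = rule A (map (\<lambda>v. c (z + v)) (nbhd A)) [s z]"
  by (simp add: global_map_def cfca_rnbhd[OF assms])

lemma global_iter_Suc_shift:
  "global_iter A (Suc n) c s = global_iter A n (global_map A c (s 1)) (\<lambda>i. s (Suc i))"
  by (induction n) auto

lemma nbhd_bound: obtains N :: int where "0 \<le> N" "\<And>v. v \<in> set (nbhd A) \<Longrightarrow> \<bar>v\<bar> \<le> N"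
proof
  \<comment> \<open>The sum of all \<bar>v\<bar>, unlike a maximum, also covers an empty
    neighbourhood.\<close>
  show "0 \<le> (\<Sum>v\<in>set (nbhd A). \<bar>v\<bar>)"
    by (simp add: sum_nonneg)
  show "\<bar>v\<bar> \<le> (\<Sum>v\<in>set (nbhd A). \<bar>v\<bar>)" if "v \<in> set (nbhd A)" for v
    using that by (intro member_le_sum) auto
qed

text \<open>Each step reads states at distance at most \<open>N\<close> and only the cell's own
  random symbol, so dependence spreads by at most \<open>N\<close> per step. Using the same window
  for the symbols of all steps keeps the induction simple.\<close>

lemma global_iter_local:
  assumes "cfca A" "0 \<le> N" "\<And>v. v \<in> set (nbhd A) \<Longrightarrow> \<bar>v\<bar> \<le> N"
    and "\<And>y. \<bar>y - z\<bar> \<le> int n * N \<Longrightarrow> c y = c' y"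
    and "\<And>i y. i \<in> {1..n} \<Longrightarrow> \<bar>y - z\<bar> \<le> int n * N \<Longrightarrow> s i y = s' i y"
  shows "global_iter A n c s z = global_iter A n c' s' z"
  using assms(4,5)
proof (induction n arbitrary: z)
  case 0
  then show ?case by simp
next
  case (Suc n)
  have "global_iter A n c s (z + v) = global_iter A n c' s' (z + v)" if "v \<in> set (nbhd A)" for v
  proof (rule Suc.IH)
    fix y assume "\<bar>y - (z + v)\<bar> \<le> int n * N"
    then have "\<bar>y - z\<bar> \<le> int (Suc n) * N"
      using assms(3)[OF that] by (simp add: distrib_right)
    then show "c y = c' y" "i \<in> {1..n} \<Longrightarrow> s i y = s' i y" for i
      using Suc.prems by auto
  qed
  moreover have "s (Suc n) z = s' (Suc n) z"
    using assms(2) by (intro Suc.prems) auto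
  ultimately show ?case
    by (auto simp: global_map_cfca[OF assms(1)] intro!: arg_cong2[where f = "rule A"])
qed

text \<open>Finitely many symbols are prescribed at finitely many times, each with positive
  probability under the uniform measure, so independence gives a finite product of positive
  factors.\<close>

lemma cylinder_prob_pos:
  fixes A :: "('q, 'r) stoch_ca" and t :: nat
  assumes "finite (symbols A)" "finite W" "s \<in> {1..t} \<rightarrow> UNIV \<rightarrow> symbols A"
  defines "C \<equiv> \<lambda>i. prod_emb UNIV (\<lambda>z. uniform_count_measure (symbols A)) W (\<Pi>\<^sub>E z\<in>W. {s i z})"
  shows "emeasure (\<Pi>\<^sub>M i\<in>{1..t}. random_measure A) (\<Pi>\<^sub>E i\<in>{1..t}. C i) > 0"
proof (cases "t = 0")
  case True
  then show ?thesis by (simp add: PiM_empty)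
next
  case False
  \<comment> \<open>For \<open>t > 0\<close> a value of \<open>s\<close> witnesses that there are
    symbols at all.\<close>
  then have "s 1 0 \<in> symbols A" using assms(3) by (auto simp: Pi_iff)
  then have ne: "symbols A \<noteq> {}" by auto
  interpret U: prob_space "uniform_count_measure (symbols A)"
    using assms(1) ne by (rule prob_space_uniform_count_measure)
  interpret P: product_prob_space "\<lambda>z::int. uniform_count_measure (symbols A)" UNIV ..
  interpret R: prob_space "random_measure A"
    unfolding random_measure_def by (rule prob_space_PiM) (rule U.prob_space_axioms)
  interpret RP: product_sigma_finite "\<lambda>i::nat. random_measure A" ..
  have C_pos: "emeasure (random_measure A) (C i) > 0" if "i \<in> {1..t}" for i
  proof -
    have "s i z \<in> symbols A" for z using assms(3) that by (auto simp: Pi_iff)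
    then show ?thesis
      unfolding C_def random_measure_def using assms(1,2) ne
      by (subst P.emeasure_PiM_emb)
         (auto simp: emeasure_uniform_count_measure sets_uniform_count_measure
            prod_ennreal zero_less_divide_iff card_gt_0_iff)
  qed
  \<comment> \<open>Non-measurable sets have \<open>emeasure\<close> 0, so positivity already yields
    measurability.\<close>
  have C_sets: "C i \<in> sets (random_measure A)" if "i \<in> {1..t}" for i
    using C_pos[OF that] by (metis emeasure_notin_sets less_numeral_extra(3))
  show ?thesis
    using C_pos C_sets by (subst RP.emeasure_PiM) (auto simp: prod_pos zero_less_iff_neq_zero)
qed

text \<open>An event of probability 1 meets every event of positive probability. Combined with
  locality, this turns almost sure statements into sure ones.\<close>

lemma law_eq_1_meets_cylinder:
  fixes A :: "('q, 'r) stoch_ca"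
  assumes "stochastic_ca A" "measure (law A t c) S = 1"
    and "finite W" "s \<in> {1..t} \<rightarrow> UNIV \<rightarrow> symbols A"
  obtains s' where "s' \<in> {1..t} \<rightarrow> UNIV \<rightarrow> symbols A" "global_iter A t c s' \<in> S"
    "\<And>i z. i \<in> {1..t} \<Longrightarrow> z \<in> W \<Longrightarrow> s' i z = s i z"
proof -
  let ?M = "\<Pi>\<^sub>M i\<in>{1..t}. random_measure A"
  let ?G = "global_iter A t c -` S \<inter> space ?M"
  define C where "C = (\<lambda>i. prod_emb UNIV (\<lambda>z. uniform_count_measure (symbols A)) W (\<Pi>\<^sub>E z\<in>W. {s i z}))"
  let ?C = "\<Pi>\<^sub>E i\<in>{1..t}. C i"
  have fin: "finite (symbols A)" and ne: "symbols A \<noteq> {}"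
    using assms(1) by (auto simp: stochastic_ca_def)
  interpret U: prob_space "uniform_count_measure (symbols A)"
    using fin ne by (rule prob_space_uniform_count_measure)
  interpret R: prob_space "random_measure A"
    unfolding random_measure_def by (rule prob_space_PiM) (rule U.prob_space_axioms)
  interpret M: prob_space ?M
    by (rule prob_space_PiM) (rule R.prob_space_axioms)
  \<comment> \<open>If \<open>global_iter\<close> were not measurable, the measure of \<open>law\<close> would be \<open>0\<close>, not \<open>1\<close>.\<close>
  have "emeasure (law A t c) S = emeasure ?M ?G"
    using assms(2) unfolding law_def distr_def measure_def
    by (auto simp: emeasure_measure_of_conv split: if_splits)
  then have prob_G: "measure ?M ?G = 1"
    using assms(2) by (simp add: measure_def)
  then have G: "?G \<in> sets ?M"
    by (metis measure_notin_sets zero_neq_one)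
  have C_pos: "emeasure ?M ?C > 0"
    unfolding C_def using cylinder_prob_pos[OF fin assms(3,4)] .
  then have C: "?C \<in> sets ?M"
    by (metis emeasure_notin_sets less_numeral_extra(3))
  have "?G \<inter> ?C \<noteq> {}"
  proof
    assume "?G \<inter> ?C = {}"
    then have "measure ?M (?G \<union> ?C) = 1 + measure ?M ?C"
      using M.finite_measure_Union[OF G C] prob_G by simp
    moreover have "measure ?M ?C > 0"
      using C_pos unfolding M.emeasure_eq_measure by (simp only: ennreal_less_zero_iff)
    ultimately show False
      using M.prob_le_1[of "?G \<union> ?C"] by linarith
  qed
  then obtain s' where s': "s' \<in> ?G" "s' \<in> ?C" by auto
  show ?thesis
  proof
    show "s' \<in> {1..t} \<rightarrow> UNIV \<rightarrow> symbols A"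
      using s'(1) by (auto simp: space_PiM random_measure_def space_uniform_count_measure PiE_iff Pi_iff)
    show "global_iter A t c s' \<in> S"
      using s'(1) by auto
    show "s' i z = s i z" if "i \<in> {1..t}" "z \<in> W" for i z
    proof -
      have "s' i \<in> C i" using s'(2) that(1) by (auto simp: PiE_iff)
      then have "restrict (s' i) W \<in> (\<Pi>\<^sub>E z\<in>W. {s i z})" by (simp add: C_def prod_emb_def)
      then show ?thesis using that(2) by (auto simp: PiE_iff restrict_def)
    qed
  qed
qed

lemma config_sum_eq_sum:
  assumes "finite W" "{i. c i \<noteq> 0} \<subseteq> W"
  shows "config_sum c = sum c W"
  unfolding config_sum_def using assms by (intro sum.mono_neutral_left) auto

text \<open>The only finite configuration with sum 0 is the zero one. Some outcome with this sum
  uses the symbols of \<open>s\<close> near \<open>z\<close>, and locality carries its value at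
  \<open>z\<close> over to \<open>s\<close>.\<close>

lemma number_conserving_iter_zero:
  assumes A: "cfca A" and nc: "number_conserving A t"
    and s: "s \<in> {1..t} \<rightarrow> UNIV \<rightarrow> symbols A"
  shows "global_iter A t (\<lambda>_. 0) s z = 0"
proof -
  obtain N where N: "0 \<le> N" "\<And>v. v \<in> set (nbhd A) \<Longrightarrow> \<bar>v\<bar> \<le> N"
    using nbhd_bound[of A] by blast
  let ?S = "{c' \<in> UNIV \<rightarrow> states A. finite_config c' \<and> config_sum c' = config_sum (\<lambda>_. 0)}"
  have law: "measure (law A t (\<lambda>_. 0)) ?S = 1"
    using nc unfolding number_conserving_def by (auto simp: finite_config_def)
  have sca: "stochastic_ca A" using A by (simp add: cfca_def)
  obtain s' where s': "global_iter A t (\<lambda>_. 0) s' \<in> ?S"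
      "\<And>i y. i \<in> {1..t} \<Longrightarrow> y \<in> {z - int t * N..z + int t * N} \<Longrightarrow> s' i y = s i y"
    by (rule law_eq_1_meets_cylinder[OF sca law finite_atLeastAtMost_int s]) blast
  have "global_iter A t (\<lambda>_. 0) s z = global_iter A t (\<lambda>_. 0) s' z"
    using s'(2) by (intro global_iter_local[OF A N]) (auto simp: abs_le_iff)
  also have "\<dots> = 0"
    using s'(1) by (auto simp: config_sum_def finite_config_def)
  finally show ?thesis .
qed

text \<open>Far from the support of \<open>c\<close> the result is 0 for all symbols, by comparison
  with the zero configuration. The remaining finitely many cells depend on a finite window of
  symbols, where a conserving outcome can be chosen to agree with \<open>s\<close>.\<close>

lemma number_conserving_surely:
  assumes A: "cfca A" and nc: "number_conserving A t"
    and c: "c \<in> UNIV \<rightarrow> states A" "finite_config c"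
    and s: "s \<in> {1..t} \<rightarrow> UNIV \<rightarrow> symbols A"
  shows "finite_config (global_iter A t c s)" "config_sum (global_iter A t c s) = config_sum c"
proof -
  obtain N where N: "0 \<le> N" "\<And>v. v \<in> set (nbhd A) \<Longrightarrow> \<bar>v\<bar> \<le> N"
    using nbhd_bound[of A] by blast
  let ?S = "{c' \<in> UNIV \<rightarrow> states A. finite_config c' \<and> config_sum c' = config_sum c}"
  have law: "measure (law A t c) ?S = 1"
    using nc c unfolding number_conserving_def by auto
  define B where "B = (\<Sum>i | c i \<noteq> 0. \<bar>i\<bar>)"
  have B: "c i = 0" if "\<bar>i\<bar> > B" for i
    using that member_le_sum[of i "{i. c i \<noteq> 0}" abs] c(2)
    unfolding B_def finite_config_def by fastforce
  define K where "K = int t * N"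
  have outside: "global_iter A t c s' z = 0"
    if "s' \<in> {1..t} \<rightarrow> UNIV \<rightarrow> symbols A" "\<bar>z\<bar> > B + K" for s' z
  proof -
    have "global_iter A t c s' z = global_iter A t (\<lambda>_. 0) s' z"
      using that(2) by (intro global_iter_local[OF A N] B) (auto simp: K_def)
    then show ?thesis using number_conserving_iter_zero[OF A nc that(1)] by simp
  qed
  have sca: "stochastic_ca A" using A by (simp add: cfca_def)
  \<comment> \<open>Cells up to distance \<open>B + K\<close> from the origin read symbols at most
    \<open>K\<close> further out, hence the radius \<open>B + 2 * K\<close>.\<close>
  obtain s' where s': "s' \<in> {1..t} \<rightarrow> UNIV \<rightarrow> symbols A" "global_iter A t c s' \<in> ?S"
      "\<And>i y. i \<in> {1..t} \<Longrightarrow> y \<in> {- B - 2 * K..B + 2 * K} \<Longrightarrow> s' i y = s i y"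
    by (rule law_eq_1_meets_cylinder[OF sca law finite_atLeastAtMost_int s]) blast
  have "global_iter A t c s = global_iter A t c s'"
  proof
    fix z
    show "global_iter A t c s z = global_iter A t c s' z"
    proof (cases "\<bar>z\<bar> > B + K")
      case True
      then show ?thesis using outside s s'(1) by metis
    next
      case False
      then show ?thesis
        by (intro global_iter_local[OF A N] refl s'(3)[symmetric]) (auto simp flip: K_def)
    qed
  qed
  then show "finite_config (global_iter A t c s)" "config_sum (global_iter A t c s) = config_sum c"
    using s'(2) by auto
qed

lemma config_sum_eq_except_one:
  assumes "finite_config c" "finite_config c'" "config_sum c = config_sum c'"
    and "\<And>z. z \<noteq> x \<Longrightarrow> c z = c' z"
  shows "c x = c' x"
proof -
  let ?W = "insert x ({i. c i \<noteq> 0} \<union> {i. c' i \<noteq> 0})"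
  have fin: "finite ?W" using assms(1,2) by (simp add: finite_config_def)
  have "sum c ?W = sum c' ?W"
    using assms(3) by (subst (1 2) config_sum_eq_sum[OF fin, symmetric]) auto
  moreover have "sum c (?W - {x}) = sum c' (?W - {x})"
    using assms(4) by (intro sum.cong) auto
  ultimately show ?thesis
    using sum.remove[OF fin, of x c] sum.remove[OF fin, of x c'] by simp
qed

text \<open>Dropping the first step from a preimage under \<open>n + 1\<close> steps leaves a
  configuration that reaches the pattern in \<open>n\<close> steps. Locality permits cutting it off
  to a finite one.\<close>

lemma surjective_reaches_pattern:
  assumes A: "cfca A" and surj: "surjective_ca A (Suc n)" and 0: "0 \<in> states A"
    and xs: "set xs \<subseteq> states A" "length xs = length (nbhd A)"
  obtains c s where "c \<in> UNIV \<rightarrow> states A" "finite_config c"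
    "s \<in> {1..n} \<rightarrow> UNIV \<rightarrow> symbols A" "map (global_iter A n c s) (nbhd A) = xs"
proof -
  obtain N where N: "0 \<le> N" "\<And>v. v \<in> set (nbhd A) \<Longrightarrow> \<bar>v\<bar> \<le> N"
    using nbhd_bound[of A] by blast
  have sca: "stochastic_ca A" and dist: "distinct (nbhd A)"
    using A by (auto simp: cfca_def stochastic_ca_def)
  \<comment> \<open>The pattern \<open>xs\<close> is placed around the origin and padded with 0;
    distinctness of \<open>nbhd A\<close> makes the lookup return the right entry.\<close>
  define d where "d z = (case map_of (zip (nbhd A) xs) z of None \<Rightarrow> 0 | Some a \<Rightarrow> a)" for z
  have "d \<in> UNIV \<rightarrow> states A"
    using 0 xs(1) by (auto simp: d_def split: option.split dest!: map_of_SomeD set_zip_rightD)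
  then obtain c' s where c': "c' \<in> UNIV \<rightarrow> states A" and s: "s \<in> {1..Suc n} \<rightarrow> UNIV \<rightarrow> symbols A"
    and d: "global_iter A (Suc n) c' s = d"
    using surj unfolding surjective_ca_def by blast
  define c1 where "c1 = global_map A c' (s 1)"
  \<comment> \<open>Neighbourhood cells lie within \<open>N\<close> of the origin and depend on
    cells within \<open>n * N\<close> of themselves.\<close>
  define c where "c z = (if \<bar>z\<bar> \<le> int (Suc n) * N then c1 z else 0)" for z
  show ?thesis
  proof
    have "c1 \<in> UNIV \<rightarrow> states A"
      unfolding c1_def using s by (intro global_map_in_states sca c') auto
    then show "c \<in> UNIV \<rightarrow> states A"
      using 0 by (auto simp: c_def)
    have "{i. c i \<noteq> 0} \<subseteq> {- (int (Suc n) * N)..int (Suc n) * N}"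
      by (auto simp: c_def abs_le_iff split: if_splits)
    then show "finite_config c"
      unfolding finite_config_def by (rule finite_subset) simp
    show "(\<lambda>i. s (Suc i)) \<in> {1..n} \<rightarrow> UNIV \<rightarrow> symbols A"
      using s by auto
    have "global_iter A n c (\<lambda>i. s (Suc i)) v = d v" if "v \<in> set (nbhd A)" for v
    proof -
      have "global_iter A n c (\<lambda>i. s (Suc i)) v = global_iter A n c1 (\<lambda>i. s (Suc i)) v"
        using N(2)[OF that]
        by (intro global_iter_local[OF A N]) (auto simp: c_def distrib_right)
      then show ?thesis
        using d by (simp only: global_iter_Suc_shift c1_def)
    qed
    then have "map (global_iter A n c (\<lambda>i. s (Suc i))) (nbhd A) = map d (nbhd A)"
      by simp
    also have "\<dots> = xs"
      using xs(2) dist by (intro nth_equalityI) (auto simp: d_def map_of_zip_nth)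
    finally show "map (global_iter A n c (\<lambda>i. s (Suc i))) (nbhd A) = xs" .
  qed
qed

theorem theorem5p4:
  fixes A :: "(nat, 'r) stoch_ca" and t :: nat
  assumes "cfca A" and "t > 0"
    and "number_conserving A t" and "surjective_ca A t"
  shows "deterministic A"
  unfolding deterministic_def
proof (intro allI impI, elim conjE)
  fix xs rs rs'
  assume xs: "set xs \<subseteq> states A" "length xs = length (nbhd A)"
    and rs: "set rs \<subseteq> symbols A" "length rs = length (rnbhd A)"
    and rs': "set rs' \<subseteq> symbols A" "length rs' = length (rnbhd A)"
  obtain n where n: "t = Suc n" using assms(2) by (cases t) auto
  obtain r r' where r: "rs = [r]" "rs' = [r']" "r \<in> symbols A" "r' \<in> symbols A"
    using rs rs' by (auto simp: cfca_rnbhd[OF assms(1)] length_Suc_conv)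
  have "0 \<in> states A" using assms(3) by (auto simp: number_conserving_def)
  then obtain c s where c: "c \<in> UNIV \<rightarrow> states A" "finite_config c"
    and s: "s \<in> {1..n} \<rightarrow> UNIV \<rightarrow> symbols A"
    and pat: "map (global_iter A n c s) (nbhd A) = xs"
    using surjective_reaches_pattern[OF assms(1) assms(4)[unfolded n] _ xs] by metis
  \<comment> \<open>In the last step all cells use \<open>r\<close>, except that the origin uses
    \<open>x\<close>.\<close>
  define e where "e x = global_iter A t c (s(t := (\<lambda>_. r)(0 := x)))" for x
  have e_eq: "e x = global_map A (global_iter A n c s) ((\<lambda>_. r)(0 := x))" for x
  proof -
    \<comment> \<open>The first \<open>n\<close> steps do not read entry
      \<open>t = Suc n\<close>.\<close>
    have "global_iter A n c (s(t := (\<lambda>_. r)(0 := x))) = global_iter A n c s"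
      by (intro ext, rule nbhd_bound[of A], rule global_iter_local[OF assms(1)]) (auto simp: n)
    then show ?thesis by (simp add: e_def n)
  qed
  have conserved: "finite_config (e x)" "config_sum (e x) = config_sum c" if "x \<in> symbols A" for x
    unfolding e_def using that r(3) s
    by (intro number_conserving_surely[OF assms(1,3) c]; auto simp: n Pi_iff le_Suc_eq)+
  \<comment> \<open>Here correlation-freeness enters: the symbol of the origin is read by the origin
    alone.\<close>
  have "e r z = e r' z" if "z \<noteq> 0" for z
    using that by (simp add: e_eq global_map_cfca[OF assms(1)])
  then have "e r 0 = e r' 0"
    using r(3,4) by (intro config_sum_eq_except_one[of "e r" "e r'" 0]) (simp_all add: conserved)
  then show "rule A xs rs = rule A xs rs'"
    by (simp add: e_eq global_map_cfca[OF assms(1)] pat r(1,2))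
qed

end
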